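(* Let $\Omega$ be a bounded connected open subset of $\mathbb{R}^n$ with $C^2$ boundary, and let $\lambda,\Lambda,\delta>0$. Then there exist constants $\bar\epsilon,\bar\mu>0$, depending only on $n,\lambda,\Lambda,\delta,\Omega$, such that the following holds. Let $a_{ij},b_i,c\in L^\infty(\Omega)$ satisfy $$|a_{ij}(x)|+|b_i(x)|+|c(x)|\le\Lambda,\qquad a_{ij}(x)\xi_i\xi_j\ge\lambda|\xi|^2\qquad\text{for all }x\in\Omega,\ \xi\in\mathbb{R}^n,$$ let $B\subset\Omega$ be a ball of radius $\delta$, and let $u\in LSC(\Omega)$ satisfy $$a_{ij}(x)\partial_{ij}u+b_i(x)\partial_iu+c(x)u\le\bar\epsilon\quad\text{in }\Omega\text{ in the viscosity sense},$$ $$u\ge0\ \text{ in }\Omega,\qquad u\ge1\ \text{ on }B.$$ Then $$u(x)\ge\bar\mu\,\mathrm{dist}(x,\partial\Omega)\quad\text{for all }x\in\Omega.$$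
   Context: $LSC(\Omega)$ is the set of lower-semicontinuous functions on $\Omega$. Repeated indices are summed over $1,\dots,n$. The coefficients are bounded measurable functions defined at every point of $\Omega$. Viscosity sense: whenever $x_0\in\Omega$ and $\varphi$ is $C^2$ near $x_0$ with $\varphi\le u$ near $x_0$ and $\varphi(x_0)=u(x_0)$, one has $a_{ij}(x_0)\partial_{ij}\varphi(x_0)+b_i(x_0)\partial_i\varphi(x_0)+c(x_0)\varphi(x_0)\le\bar\epsilon$. *)

theory Defs
  imports "HOL-Analysis.Analysis"
begin

text \<open>The value is meaningful only where \<open>f\<close> is differentiable; every use below is guarded by
  \<open>C2_on\<close>.\<close>

definition partial_deriv :: "'n::finite \<Rightarrow> (real^'n \<Rightarrow> real) \<Rightarrow> real^'n \<Rightarrow> real" where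
  "partial_deriv i f x = frechet_derivative f (at x) (axis i 1)"

definition C2_on :: "(real^'n::finite) set \<Rightarrow> (real^'n \<Rightarrow> real) \<Rightarrow> bool" where
  "C2_on U f \<longleftrightarrow> open U
     \<and> (\<forall>x\<in>U. f differentiable (at x))
     \<and> (\<forall>i. \<forall>x\<in>U. partial_deriv i f differentiable (at x))
     \<and> (\<forall>i j. continuous_on U (partial_deriv i (partial_deriv j f)))"

text \<open>Near each boundary point the set is the strict supergraph, in the direction of a unit
  vector \<open>\<nu>\<close>, of a \<open>C\<^sup>2\<close> function of the remaining \<open>n - 1\<close> orthogonal coordinates. Such a
  function is encoded as a \<open>C\<^sup>2\<close> function \<open>\<gamma>\<close> on the whole space that is constant along \<open>\<nu>\<close>.\<close>

definition has_C2_boundary :: "(real^'n::finite) set \<Rightarrow> bool" where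
  "has_C2_boundary \<Omega> \<longleftrightarrow>
     (\<forall>p\<in>frontier \<Omega>. \<exists>r>0. \<exists>\<nu> \<gamma>. norm \<nu> = 1 \<and> C2_on UNIV \<gamma>
        \<and> (\<forall>x t. \<gamma> (x + t *\<^sub>R \<nu>) = \<gamma> x)
        \<and> \<Omega> \<inter> ball p r = {x \<in> ball p r. \<gamma> x < x \<bullet> \<nu>})"

definition lsc_on :: "(real^'n::finite) set \<Rightarrow> (real^'n \<Rightarrow> real) \<Rightarrow> bool" where
  "lsc_on \<Omega> u \<longleftrightarrow> (\<forall>x\<in>\<Omega>. \<forall>t<u x. \<forall>\<^sub>F y in at x within \<Omega>. t < u y)"

definition elliptic_op ::
  "(real^'n::finite \<Rightarrow> real^'n^'n) \<Rightarrow> (real^'n \<Rightarrow> real^'n) \<Rightarrow> (real^'n \<Rightarrow> real)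
     \<Rightarrow> (real^'n \<Rightarrow> real) \<Rightarrow> real^'n \<Rightarrow> real" where
  "elliptic_op a b c \<phi> x =
     (\<Sum>i\<in>UNIV. \<Sum>j\<in>UNIV. a x $ i $ j * partial_deriv i (partial_deriv j \<phi>) x)
     + (\<Sum>i\<in>UNIV. b x $ i * partial_deriv i \<phi> x) + c x * \<phi> x"

definition viscosity_le ::
  "(real^'n::finite) set \<Rightarrow> (real^'n \<Rightarrow> real^'n^'n) \<Rightarrow> (real^'n \<Rightarrow> real^'n) \<Rightarrow> (real^'n \<Rightarrow> real)
     \<Rightarrow> (real^'n \<Rightarrow> real) \<Rightarrow> real \<Rightarrow> bool" where
  "viscosity_le \<Omega> a b c u e \<longleftrightarrow>
     (\<forall>x0\<in>\<Omega>. \<forall>\<phi> U. x0 \<in> U \<and> U \<subseteq> \<Omega> \<and> C2_on U \<phi> \<and> (\<forall>x\<in>U. \<phi> x \<le> u x) \<and> \<phi> x0 = u x0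
        \<longrightarrow> elliptic_op a b c \<phi> x0 \<le> e)"

text \<open>The bounds hold at every point of \<open>\<Omega>\<close>, not just almost everywhere, so together with
  measurability the first one also makes the coefficients elements of \<open>L\<^sup>\<infinity>(\<Omega>)\<close>. No symmetry
  of \<open>a\<close> is assumed.\<close>

definition admissible_coeffs ::
  "(real^'n::finite) set \<Rightarrow> real \<Rightarrow> real
     \<Rightarrow> (real^'n \<Rightarrow> real^'n^'n) \<Rightarrow> (real^'n \<Rightarrow> real^'n) \<Rightarrow> (real^'n \<Rightarrow> real) \<Rightarrow> bool" where
  "admissible_coeffs \<Omega> lam Lam a b c \<longleftrightarrow>
     (\<forall>i j. (\<lambda>x. a x $ i $ j) \<in> borel_measurable (lebesgue_on \<Omega>))
     \<and> (\<forall>i. (\<lambda>x. b x $ i) \<in> borel_measurable (lebesgue_on \<Omega>))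
     \<and> c \<in> borel_measurable (lebesgue_on \<Omega>)
     \<and> (\<forall>x\<in>\<Omega>. \<forall>i j. \<bar>a x $ i $ j\<bar> + \<bar>b x $ i\<bar> + \<bar>c x\<bar> \<le> Lam)
     \<and> (\<forall>x\<in>\<Omega>. \<forall>\<xi>. lam * (norm \<xi>)\<^sup>2 \<le> (\<Sum>i\<in>UNIV. \<Sum>j\<in>UNIV. a x $ i $ j * \<xi> $ i * \<xi> $ j))"

end

theory Submission
  imports Defs
begin

text \<open>If the right-hand side is small compared with \<open>m\<close>, a nonnegative supersolution that
  is at least \<open>m\<close> on a small ball lies above \<open>m\<close> times the barrier
  \<open>exp (- \<alpha> |x - y|\<^sup>2) - exp (- \<alpha> R\<^sup>2)\<close> on any concentric
  ball of radius \<open>R\<close> inside the domain (\<open>supersolution_spreads\<close>): for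
  large \<open>\<alpha>\<close> the barrier is a strict subsolution off the small ball, so it
  cannot touch a supersolution from below there. The zeroth order term, whose coefficient may have
  either sign, is absorbed because at a touching point the lowered barrier takes the value of the
  supersolution, which lies between \<open>0\<close> and the value of the barrier. Near the sphere
  of radius \<open>R\<close> the barrier grows at least linearly in the distance to the sphere, as
  in Hopf's lemma.

  Everything else is compactness. The points with a neighbourhood on which all supersolutions share
  a positive lower bound form a subset of the domain that is open and, by the barrier, relatively
  closed; connectedness makes it the whole domain, hence there is a common positive lower bound on
  every compact subset (\<open>lower_bound_compact\<close>). A \<open>C\<^sup>2\<close> boundary admits interior spheres of a radius
  that is locally uniform (\<open>interior_sphere\<close>). Applying the barrier in these balls, whose concentric
  halves stay in one compact subset of the domain, turns the bound on compact sets into a bound by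
  the distance near each boundary point. A finite cover of the closure of the domain gives one
  constant for a fixed position of the small ball, and a finite set of balls of half the
  radius gives one constant for all positions.\<close>

section \<open>The Gaussian barrier\<close>

lemma partial_deriv_eqI:
  "(f has_derivative D) (at x) \<Longrightarrow> partial_deriv i f x = D (axis i 1)"
  unfolding partial_deriv_def by (simp add: frechet_derivative_at[symmetric])

definition gaussian :: "real \<Rightarrow> real \<Rightarrow> real \<Rightarrow> real^'n::finite \<Rightarrow> real^'n \<Rightarrow> real" where
  "gaussian \<alpha> m k y x = m * exp (- \<alpha> * (norm (x - y))\<^sup>2) - k"

lemma has_derivative_exp_sq:
  fixes y :: "real^'n::finite"
  shows "((\<lambda>x. exp (- \<alpha> * (norm (x - y))\<^sup>2)) has_derivative
     (\<lambda>h. - 2 * \<alpha> * exp (- \<alpha> * (norm (x - y))\<^sup>2) * ((x - y) \<bullet> h))) (at x)"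
proof -
  have "((\<lambda>x. (norm (x - y))\<^sup>2) has_derivative (\<lambda>h. 2 * ((x - y) \<bullet> h))) (at x)"
    unfolding power2_norm_eq_inner
    by (auto intro!: derivative_eq_intros simp: inner_commute)
  from has_derivative_exp[OF has_derivative_mult_right[OF this, of "- \<alpha>"]]
  show ?thesis by (simp add: mult_ac)
qed

lemma gaussian_has_derivative:
  "(gaussian \<alpha> m k y has_derivative
     (\<lambda>h. m * (- 2 * \<alpha> * exp (- \<alpha> * (norm (x - y))\<^sup>2) * ((x - y) \<bullet> h)))) (at x)"
  unfolding gaussian_def
  using has_derivative_diff[OF has_derivative_mult_right[OF has_derivative_exp_sq, of m] has_derivative_const]
  by simp

lemma partial_deriv_gaussian:
  "partial_deriv j (gaussian \<alpha> m k y) =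
     (\<lambda>x. - 2 * \<alpha> * m * (exp (- \<alpha> * (norm (x - y))\<^sup>2) * (x - y) $ j))"
  by (rule ext) (simp add: partial_deriv_eqI[OF gaussian_has_derivative] inner_axis)

lemma partial_gaussian_has_derivative:
  "(partial_deriv j (gaussian \<alpha> m k y) has_derivative
     (\<lambda>h. m * exp (- \<alpha> * (norm (x - y))\<^sup>2)
        * (4 * \<alpha>\<^sup>2 * (x - y) $ j * ((x - y) \<bullet> h) - 2 * \<alpha> * h $ j))) (at x)"
proof -
  have "((\<lambda>x. (x - y) $ j) has_derivative (\<lambda>h. h $ j)) (at x)"
    using bounded_linear.has_derivative[OF bounded_linear_vec_nth
        has_derivative_diff[OF has_derivative_ident has_derivative_const]] by simp
  from has_derivative_mult_right[OF has_derivative_mult[OF has_derivative_exp_sq this], of "- 2 * \<alpha> * m"]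
  show ?thesis
    unfolding partial_deriv_gaussian
    by (rule has_derivative_eq_rhs) (auto simp: algebra_simps power2_eq_square)
qed

lemma partial2_gaussian:
  "partial_deriv i (partial_deriv j (gaussian \<alpha> m k y)) =
     (\<lambda>x. m * exp (- \<alpha> * (norm (x - y))\<^sup>2)
        * (4 * \<alpha>\<^sup>2 * (x - y) $ i * (x - y) $ j - (if i = j then 2 * \<alpha> else 0)))"
  by (rule ext)
    (simp add: partial_deriv_eqI[OF partial_gaussian_has_derivative] inner_axis,
      simp add: axis_def)

lemma C2_on_gaussian: "open U \<Longrightarrow> C2_on U (gaussian \<alpha> m k y)"
  unfolding C2_on_def
  by (auto simp: partial2_gaussian intro!: continuous_intros
      differentiableI[OF gaussian_has_derivative] differentiableI[OF partial_gaussian_has_derivative])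

text \<open>Where \<open>|x - y| \<ge> r\<close>, ellipticity makes the part of the second derivatives that is quadratic in
  \<open>\<alpha>\<close> positive, and it dominates the other terms, which are at most linear in \<open>\<alpha>\<close>, once \<open>\<alpha>\<close> is large.
  The subtracted constant \<open>k\<close> is free so that the estimate also covers the barrier lowered until it
  touches; nonnegativity at \<open>x\<close> is what bounds the zeroth order term by \<open>Lam\<close> times the exponential,
  whatever the sign of \<open>c\<close>.\<close>
lemma elliptic_op_gaussian_ge:
  fixes a :: "real^'n::finite \<Rightarrow> real^'n^'n"
  assumes adm: "admissible_coeffs \<Omega> lam Lam a b c" and x: "x \<in> \<Omega>"
    and "0 < \<alpha>" "0 < lam" "0 \<le> m" "0 < r" and rx: "r \<le> norm (x - y)" and xR: "norm (x - y) \<le> R"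
    and g0: "0 \<le> gaussian \<alpha> m k y x" and "0 \<le> k"
  shows "m * exp (- \<alpha> * (norm (x - y))\<^sup>2)
           * (4 * \<alpha>\<^sup>2 * lam * r\<^sup>2 - 2 * \<alpha> * real CARD('n) * Lam * (1 + R) - Lam)
         \<le> elliptic_op a b c (gaussian \<alpha> m k y) x"
proof -
  define v where "v = x - y"
  define E where "E = m * exp (- \<alpha> * (norm v)\<^sup>2)"
  have E0: "0 \<le> E" using \<open>0 \<le> m\<close> by (simp add: E_def)
  have bnd: "\<bar>a x $ i $ j\<bar> + \<bar>b x $ i\<bar> + \<bar>c x\<bar> \<le> Lam" for i j
    using adm x by (auto simp: admissible_coeffs_def)
  have a: "a x $ i $ i \<le> Lam" and b: "\<bar>b x $ i\<bar> \<le> Lam" and c: "\<bar>c x\<bar> \<le> Lam" for i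
    using bnd[of i i] by linarith+
  have Lam0: "0 \<le> Lam" using c by linarith
  have "lam * r\<^sup>2 \<le> lam * (norm v)\<^sup>2"
    using rx \<open>0 < r\<close> \<open>0 < lam\<close> by (auto simp: v_def intro!: mult_left_mono power_mono)
  also have "\<dots> \<le> (\<Sum>i\<in>UNIV. \<Sum>j\<in>UNIV. a x $ i $ j * v $ i * v $ j)"
    using adm x by (auto simp: admissible_coeffs_def)
  finally have ell: "lam * r\<^sup>2 \<le> (\<Sum>i\<in>UNIV. \<Sum>j\<in>UNIV. a x $ i $ j * v $ i * v $ j)" .
  have tr: "(\<Sum>i\<in>UNIV. a x $ i $ i) \<le> real CARD('n) * Lam"
    using sum_bounded_above[of UNIV "\<lambda>i. a x $ i $ i" Lam] a by simp
  have drift: "(\<Sum>i\<in>UNIV. b x $ i * v $ i) \<le> real CARD('n) * (Lam * R)"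
  proof -
    have "b x $ i * v $ i \<le> Lam * R" for i
    proof -
      have "b x $ i * v $ i \<le> \<bar>b x $ i\<bar> * \<bar>v $ i\<bar>" by (metis abs_ge_self abs_mult)
      also have "\<dots> \<le> Lam * R"
        using b component_le_norm_cart[of v i] xR Lam0 by (intro mult_mono) (auto simp: v_def)
      finally show ?thesis .
    qed
    then show ?thesis
      using sum_bounded_above[of UNIV "\<lambda>i. b x $ i * v $ i" "Lam * R"] by simp
  qed
  have zero: "- (Lam * E) \<le> c x * gaussian \<alpha> m k y x"
  proof -
    have "- (c x * gaussian \<alpha> m k y x) \<le> \<bar>c x\<bar> * gaussian \<alpha> m k y x"
      using g0 mult_right_mono[of "- c x" "\<bar>c x\<bar>" "gaussian \<alpha> m k y x"] by simp
    also have "\<dots> \<le> Lam * E"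
      using c g0 Lam0 \<open>0 \<le> k\<close> by (intro mult_mono) (auto simp: gaussian_def E_def v_def)
    finally show ?thesis by simp
  qed
  have "(\<Sum>i\<in>UNIV. \<Sum>j\<in>UNIV. a x $ i $ j * partial_deriv i (partial_deriv j (gaussian \<alpha> m k y)) x)
      = (\<Sum>i\<in>UNIV. \<Sum>j\<in>UNIV. E * (4 * \<alpha>\<^sup>2) * (a x $ i $ j * v $ i * v $ j)
           - (if i = j then E * (2 * \<alpha>) * a x $ i $ j else 0))"
    unfolding partial2_gaussian E_def v_def
    by (intro sum.cong refl) (auto simp: algebra_simps)
  also have "\<dots> = E * (4 * \<alpha>\<^sup>2) * (\<Sum>i\<in>UNIV. \<Sum>j\<in>UNIV. a x $ i $ j * v $ i * v $ j)
                   - E * (2 * \<alpha>) * (\<Sum>i\<in>UNIV. a x $ i $ i)"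
    by (simp add: sum_subtractf sum_distrib_left)
  also have "\<dots> \<ge> E * (4 * \<alpha>\<^sup>2) * (lam * r\<^sup>2) - E * (2 * \<alpha>) * (real CARD('n) * Lam)"
    using E0 \<open>0 < \<alpha>\<close> by (intro diff_mono mult_left_mono ell tr) auto
  finally have 2: "E * (4 * \<alpha>\<^sup>2) * (lam * r\<^sup>2) - E * (2 * \<alpha>) * (real CARD('n) * Lam)
      \<le> (\<Sum>i\<in>UNIV. \<Sum>j\<in>UNIV. a x $ i $ j * partial_deriv i (partial_deriv j (gaussian \<alpha> m k y)) x)" .
  have "(\<Sum>i\<in>UNIV. b x $ i * partial_deriv i (gaussian \<alpha> m k y) x)
      = - (E * (2 * \<alpha>)) * (\<Sum>i\<in>UNIV. b x $ i * v $ i)"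
    unfolding partial_deriv_gaussian E_def v_def sum_distrib_left
    by (intro sum.cong refl) (auto simp: algebra_simps)
  then have 1: "- (E * (2 * \<alpha>) * (real CARD('n) * (Lam * R)))
      \<le> (\<Sum>i\<in>UNIV. b x $ i * partial_deriv i (gaussian \<alpha> m k y) x)"
    using mult_left_mono[OF drift, of "E * (2 * \<alpha>)"] E0 \<open>0 < \<alpha>\<close> by simp
  show ?thesis
    using 1 2 zero unfolding elliptic_op_def v_def[symmetric] E_def[symmetric]
    by (simp add: algebra_simps)
qed

section \<open>Comparison with the barrier\<close>

text \<open>If the infimum were not attained, the sets where \<open>u - \<phi>\<close> exceeds one of its values on \<open>K\<close>, which
  are open by semicontinuity, would cover \<open>K\<close>; a point with the smallest value in a finite subcover
  is not covered.\<close>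
lemma lsc_on_attains_inf_minus:
  fixes u \<phi> :: "real^'n::finite \<Rightarrow> real"
  assumes "open \<Omega>" and lsc: "lsc_on \<Omega> u" and cont: "continuous_on UNIV \<phi>"
    and K: "compact K" "K \<subseteq> \<Omega>" "K \<noteq> {}"
  shows "\<exists>x\<in>K. \<forall>y\<in>K. u x - \<phi> x \<le> u y - \<phi> y"
proof -
  define f where "f x = u x - \<phi> x" for x
  define V where "V t = {x \<in> \<Omega>. t < f x}" for t
  have "\<exists>T. open T \<and> x \<in> T \<and> T \<subseteq> V t" if "x \<in> V t" for x t
  proof -
    have x: "x \<in> \<Omega>" "t < f x" using that by (auto simp: V_def)
    define e where "e = (f x - t) / 2"
    have e: "0 < e" using x by (simp add: e_def)
    have x\<Omega>: "x \<in> \<Omega>" using x by blast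
    have lt: "u x - e < u x" using e by linarith
    have "\<forall>\<^sub>F y in at x within \<Omega>. u x - e < u y"
      using lsc x\<Omega> lt unfolding lsc_on_def by blast
    then have 1: "\<forall>\<^sub>F y in nhds x. u x - e < u y"
      unfolding at_within_open[OF x\<Omega> \<open>open \<Omega>\<close>] eventually_nhds_conv_at using lt by blast
    have "isCont \<phi> x" using cont by (simp add: continuous_on_eq_continuous_at)
    then have "(\<phi> \<longlongrightarrow> \<phi> x) (nhds x)"
      unfolding isCont_def tendsto_at_iff_tendsto_nhds .
    then have 2: "\<forall>\<^sub>F y in nhds x. \<phi> y < \<phi> x + e" by (rule order_tendstoD(2)) (use e in linarith)
    have 3: "\<forall>\<^sub>F y in nhds x. y \<in> \<Omega>" by (rule eventually_nhds_in_open[OF \<open>open \<Omega>\<close> x\<Omega>])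
    have "\<forall>\<^sub>F y in nhds x. y \<in> V t"
      using 1 2 3 by eventually_elim (auto simp: V_def f_def e_def field_simps)
    then show ?thesis unfolding eventually_nhds by blast
  qed
  then have open_V: "open (V t)" for t by (subst open_subopen) blast
  show ?thesis
  proof (rule ccontr)
    assume "\<not> ?thesis"
    then have *: "\<forall>x\<in>K. \<exists>y\<in>K. f y < f x" by (auto simp: f_def not_le)
    have "K \<subseteq> (\<Union>y\<in>K. V (f y))"
    proof
      fix x assume "x \<in> K"
      then obtain y where "y \<in> K" "f y < f x" using * by blast
      then show "x \<in> (\<Union>y\<in>K. V (f y))" using \<open>x \<in> K\<close> K by (auto simp: V_def)
    qed
    then obtain D where D: "D \<subseteq> K" "finite D" "K \<subseteq> (\<Union>y\<in>D. V (f y))"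
      by (rule compactE_image[OF \<open>compact K\<close> open_V])
    then have "D \<noteq> {}" using K by auto
    define y where "y = arg_min_on f D"
    have "y \<in> D" and least: "\<And>z. z \<in> D \<Longrightarrow> \<not> f z < f y"
      using arg_min_if_finite[OF \<open>finite D\<close> \<open>D \<noteq> {}\<close>, of f] by (auto simp: y_def)
    obtain z where "z \<in> D" "y \<in> V (f z)" using D \<open>y \<in> D\<close> by blast
    then show False using least[of z] by (auto simp: V_def)
  qed
qed

text \<open>The coefficients are quantified away, since the bounds below are uniform in them.\<close>
definition nonneg_supersolution ::
  "(real^'n::finite) set \<Rightarrow> real \<Rightarrow> real \<Rightarrow> real \<Rightarrow> (real^'n \<Rightarrow> real) \<Rightarrow> bool" where
  "nonneg_supersolution \<Omega> lam Lam \<epsilon> u \<longleftrightarrow>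
     (\<exists>a b c. admissible_coeffs \<Omega> lam Lam a b c \<and> viscosity_le \<Omega> a b c u \<epsilon>)
     \<and> lsc_on \<Omega> u \<and> (\<forall>x\<in>\<Omega>. 0 \<le> u x)"

lemma nonneg_supersolution_mono:
  "nonneg_supersolution \<Omega> lam Lam \<epsilon> u \<Longrightarrow> \<epsilon> \<le> \<epsilon>' \<Longrightarrow> nonneg_supersolution \<Omega> lam Lam \<epsilon>' u"
  unfolding nonneg_supersolution_def viscosity_le_def by (meson order_trans)

text \<open>If \<open>u\<close> were below the barrier somewhere, the barrier lowered by the largest excess \<open>d\<close> would
  touch \<open>u\<close> from below at some \<open>x0\<close>. This point is not in the small ball, where \<open>u \<ge> m\<close> exceeds the
  barrier, nor near the outer sphere, where the barrier vanishes. Hence \<open>x0\<close> lies in the annulus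
  where the barrier is a strict subsolution, a contradiction. As \<open>\<Omega>\<close> may touch the outer sphere,
  the minimum is taken over the part of the ball where the barrier is at least the excess at \<open>x1\<close>,
  which is a compact subset of the open ball.\<close>
lemma gaussian_le_supersolution:
  fixes \<Omega> :: "(real^'n::finite) set"
  assumes "open \<Omega>" and u: "nonneg_supersolution \<Omega> lam Lam \<epsilon> u" and ball: "ball y R \<subseteq> \<Omega>"
    and "0 < lam" "0 < r" "r < R" "0 < m" "0 < \<alpha>"
    and ur: "\<And>x. x \<in> ball y r \<Longrightarrow> m \<le> u x"
    and \<alpha>: "1 \<le> 4 * \<alpha>\<^sup>2 * lam * r\<^sup>2 - 2 * \<alpha> * real CARD('n) * Lam * (1 + R) - Lam"
    and \<epsilon>: "\<epsilon> < m * exp (- \<alpha> * R\<^sup>2)"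
    and x1: "x1 \<in> ball y R"
  shows "gaussian \<alpha> m (m * exp (- \<alpha> * R\<^sup>2)) y x1 \<le> u x1"
proof (rule ccontr)
  obtain a b c where adm: "admissible_coeffs \<Omega> lam Lam a b c" and visc: "viscosity_le \<Omega> a b c u \<epsilon>"
    and lsc: "lsc_on \<Omega> u" and u0: "\<And>x. x \<in> \<Omega> \<Longrightarrow> 0 \<le> u x"
    using u by (auto simp: nonneg_supersolution_def)
  define k where "k = m * exp (- \<alpha> * R\<^sup>2)"
  have k: "0 < k" using \<open>0 < m\<close> by (simp add: k_def)
  define \<phi> where "\<phi> = gaussian \<alpha> m k y"
  assume "\<not> ?thesis"
  then have x1': "u x1 < \<phi> x1" by (simp add: \<phi>_def k_def)
  define \<eta> where "\<eta> = \<phi> x1 - u x1"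
  have \<eta>: "0 < \<eta>" using x1' by (simp add: \<eta>_def)
  have cont: "continuous_on UNIV \<phi>"
    unfolding \<phi>_def gaussian_def by (intro continuous_intros)
  define K where "K = cball y R \<inter> {x. \<eta> \<le> \<phi> x}"
  have "closed {x. \<eta> \<le> \<phi> x}" by (intro closed_Collect_le continuous_intros cont)
  then have "compact K" unfolding K_def by (intro compact_Int_closed compact_cball)
  have sphere: "\<phi> x = 0" if "dist y x = R" for x
    using that by (simp add: \<phi>_def gaussian_def k_def dist_norm norm_minus_commute)
  have K_ball: "K \<subseteq> ball y R"
  proof
    fix x assume "x \<in> K"
    then have "dist y x \<le> R" "\<phi> x \<noteq> 0" using \<eta> by (auto simp: K_def)
    then show "x \<in> ball y R" using sphere[of x] by (cases "dist y x = R") auto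
  qed
  have x1K: "x1 \<in> K"
    using x1 u0[of x1] ball by (auto simp: K_def \<eta>_def)
  obtain x0 where x0: "x0 \<in> K" and min: "\<And>x. x \<in> K \<Longrightarrow> u x0 - \<phi> x0 \<le> u x - \<phi> x"
    using lsc_on_attains_inf_minus[OF \<open>open \<Omega>\<close> lsc cont \<open>compact K\<close>] K_ball ball x1K by blast
  define d where "d = \<phi> x0 - u x0"
  have d: "\<eta> \<le> d" using min[OF x1K] by (simp add: d_def \<eta>_def)
  define \<psi> where "\<psi> = gaussian \<alpha> m (k + d) y"
  have \<psi>: "\<psi> x = \<phi> x - d" for x by (simp add: \<psi>_def \<phi>_def gaussian_def)
  have x0b: "x0 \<in> ball y R" and x0\<Omega>: "x0 \<in> \<Omega>" using x0 K_ball ball by auto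
  have below: "\<psi> x \<le> u x" if "x \<in> ball y R" for x
  proof (cases "x \<in> K")
    case True
    then show ?thesis using min[OF True] by (simp add: \<psi> d_def)
  next
    case False
    then have "\<phi> x < \<eta>" using that by (auto simp: K_def)
    then show ?thesis using d u0[of x] that ball by (auto simp: \<psi>)
  qed
  have touch: "\<psi> x0 = u x0" by (simp add: \<psi> d_def)
  have "elliptic_op a b c \<psi> x0 \<le> \<epsilon>"
    using visc x0\<Omega> x0b ball below touch C2_on_gaussian[of "ball y R" \<alpha> m "k + d" y]
    unfolding viscosity_le_def \<psi>_def by (metis open_ball)
  moreover have "m * exp (- \<alpha> * (norm (x0 - y))\<^sup>2)
      * (4 * \<alpha>\<^sup>2 * lam * r\<^sup>2 - 2 * \<alpha> * real CARD('n) * Lam * (1 + R) - Lam)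
    \<le> elliptic_op a b c \<psi> x0" (is "?E * ?Q \<le> _")
    unfolding \<psi>_def
  proof (rule elliptic_op_gaussian_ge[OF adm x0\<Omega> \<open>0 < \<alpha>\<close> \<open>0 < lam\<close> _ \<open>0 < r\<close>])
    show "r \<le> norm (x0 - y)"
    proof (rule ccontr)
      assume "\<not> ?thesis"
      then have "m \<le> u x0" by (intro ur) (simp add: dist_norm norm_minus_commute)
      moreover have "m * exp (- \<alpha> * (norm (x0 - y))\<^sup>2) \<le> m * 1"
        using \<open>0 < m\<close> \<open>0 < \<alpha>\<close> by (intro mult_left_mono) auto
      then have "\<phi> x0 \<le> m" using k unfolding \<phi>_def gaussian_def by linarith
      ultimately show False using d \<eta> by (simp add: d_def)
    qed
    show "norm (x0 - y) \<le> R" using x0b by (simp add: dist_norm norm_minus_commute)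
    show "0 \<le> gaussian \<alpha> m (k + d) y x0"
      using touch u0[OF x0\<Omega>] by (simp add: \<psi>_def)
  qed (use \<open>0 < m\<close> k d \<eta> in auto)
  moreover have "k \<le> ?E"
    unfolding k_def using x0b \<open>0 < m\<close> \<open>0 < \<alpha>\<close>
    by (auto simp: dist_norm norm_minus_commute intro!: mult_left_mono power_mono)
  moreover have "?E \<le> ?E * ?Q" 
    using mult_left_mono[OF \<alpha>, of ?E] \<open>0 < m\<close> by simp
  ultimately show False using \<epsilon> by (simp add: k_def)
qed

text \<open>The quantitative step: the constant \<open>\<kappa>\<close> depends only on the ellipticity constants and the two
  radii, not on the supersolution, the domain or the centre. The factor \<open>R - dist x y\<close> is kept
  because it becomes the distance to the boundary when the outer ball touches it.\<close>
lemma supersolution_spreads: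
  fixes lam Lam r R :: real
  assumes "0 < lam" "0 < Lam" "0 < r" "r < R"
  obtains \<kappa> where "0 < \<kappa>"
    "\<And>\<Omega> u m \<epsilon> y x. \<lbrakk>open \<Omega>; nonneg_supersolution (\<Omega> :: (real^'n::finite) set) lam Lam \<epsilon> u;
       ball y R \<subseteq> \<Omega>; 0 < m; \<And>w. w \<in> ball y r \<Longrightarrow> m \<le> u w; \<epsilon> \<le> \<kappa> * m; x \<in> ball y R\<rbrakk>
     \<Longrightarrow> \<kappa> * m * (R - dist x y) \<le> u x"
proof -
  \<comment> \<open>\<open>\<alpha>\<close> is chosen so that \<open>4 \<alpha> lam r\<^sup>2 \<ge> N\<close>; multiplying by \<open>\<alpha> \<ge> 1\<close> gives the condition on \<open>\<alpha>\<close> in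
    the comparison.\<close>
  define N where "N = 2 * real CARD('n) * Lam * (1 + R) + Lam + 1"
  define \<alpha> where "\<alpha> = 1 + N / (4 * lam * r\<^sup>2)"
  have N: "0 < N" using assms by (simp add: N_def add_nonneg_pos)
  have \<alpha>1: "1 \<le> \<alpha>" using N assms by (simp add: \<alpha>_def)
  have "N \<le> 4 * \<alpha> * lam * r\<^sup>2"
    using assms N by (simp add: \<alpha>_def field_simps)
  then have "\<alpha> * N \<le> \<alpha> * (4 * \<alpha> * lam * r\<^sup>2)" using \<alpha>1 by (intro mult_left_mono) auto
  moreover have "2 * \<alpha> * real CARD('n) * Lam * (1 + R) + Lam + 1 \<le> \<alpha> * N"
    using mult_right_mono[OF \<alpha>1, of "Lam + 1"] assms by (simp add: N_def algebra_simps)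
  ultimately have \<alpha>: "1 \<le> 4 * \<alpha>\<^sup>2 * lam * r\<^sup>2 - 2 * \<alpha> * real CARD('n) * Lam * (1 + R) - Lam"
    by (simp add: power2_eq_square mult_ac)
  define e where "e = exp (- \<alpha> * R\<^sup>2)"
  have e: "0 < e" by (simp add: e_def)
  define \<kappa> where "\<kappa> = min (e / 2) (e * \<alpha> * R)"
  have "0 < \<kappa>" using assms \<alpha>1 e by (simp add: \<kappa>_def)
  moreover have "\<kappa> * m * (R - dist x y) \<le> u x"
    if *: "open \<Omega>" "nonneg_supersolution \<Omega> lam Lam \<epsilon> u" "ball y R \<subseteq> \<Omega>" "0 < m"
      "\<And>w. w \<in> ball y r \<Longrightarrow> m \<le> u w" "\<epsilon> \<le> \<kappa> * m" "x \<in> ball y R"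
    for \<Omega> :: "(real^'n) set" and u m \<epsilon> y x
  proof -
    define s where "s = dist x y"
    have s: "0 \<le> s" "s < R" using * by (auto simp: s_def dist_commute)
    have "\<kappa> \<le> e / 2" by (simp add: \<kappa>_def)
    then have "\<kappa> < e" using e by linarith
    then have "\<kappa> * m < m * e" using \<open>0 < m\<close> by simp
    then have \<epsilon>: "\<epsilon> < m * exp (- \<alpha> * R\<^sup>2)"
      using \<open>\<epsilon> \<le> \<kappa> * m\<close> unfolding e_def by linarith
    have "gaussian \<alpha> m (m * exp (- \<alpha> * R\<^sup>2)) y x \<le> u x"
      using * assms \<alpha> \<epsilon> \<alpha>1 by (intro gaussian_le_supersolution[where r = r]) auto
    then have "m * (exp (- \<alpha> * s\<^sup>2) - e) \<le> u x"
      by (simp add: gaussian_def e_def s_def dist_norm algebra_simps)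
    moreover have "exp (- \<alpha> * s\<^sup>2) = e * exp (\<alpha> * (R\<^sup>2 - s\<^sup>2))"
      by (simp add: e_def exp_add[symmetric] algebra_simps)
    \<comment> \<open>Linear growth at the outer sphere comes from the tangent line of the exponential function.\<close>
    moreover have "e * (1 + \<alpha> * (R\<^sup>2 - s\<^sup>2)) \<le> e * exp (\<alpha> * (R\<^sup>2 - s\<^sup>2))"
      using e by (intro mult_left_mono exp_ge_add_one_self) auto
    ultimately have "m * (e * (\<alpha> * (R\<^sup>2 - s\<^sup>2))) \<le> u x"
      using mult_left_mono[of "e * (\<alpha> * (R\<^sup>2 - s\<^sup>2))" "exp (- \<alpha> * s\<^sup>2) - e" m] \<open>0 < m\<close>
      by (simp add: algebra_simps)
    moreover have "R * (R - s) \<le> R\<^sup>2 - s\<^sup>2"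
      using mult_right_mono[of s R s] s by (simp add: power2_eq_square algebra_simps)
    then have "m * (e * (\<alpha> * (R * (R - s)))) \<le> m * (e * (\<alpha> * (R\<^sup>2 - s\<^sup>2)))"
      using \<open>0 < m\<close> e \<alpha>1 by (intro mult_left_mono) auto
    moreover have "\<kappa> * (m * (R - s)) \<le> (e * \<alpha> * R) * (m * (R - s))"
      using \<open>0 < m\<close> s by (intro mult_right_mono) (auto simp: \<kappa>_def)
    ultimately show ?thesis by (simp add: s_def mult_ac)
  qed
  ultimately show thesis by (rule that)
qed

section \<open>Lower bounds shared by all supersolutions\<close>

locale elliptic_class =
  fixes \<Omega> :: "(real^'n::finite) set" and lam Lam :: real
  assumes open_domain: "open \<Omega>" and lam_pos: "0 < lam" and Lam_pos: "0 < Lam"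
begin

text \<open>All supersolutions that are at least \<open>1\<close> on \<open>B\<close> share the lower bound \<open>t * w\<close> on \<open>S\<close>. The same
  small number \<open>t\<close> serves as right-hand side of the equation and as the factor of the bound, and the
  bound is required for all sufficiently small \<open>t > 0\<close>: with this filter finitely many bounds hold
  simultaneously without comparing their constants.\<close>
definition lower_bound :: "(real^'n) set \<Rightarrow> (real^'n \<Rightarrow> real) \<Rightarrow> (real^'n) set \<Rightarrow> bool" where
  "lower_bound B w S \<longleftrightarrow>
     (\<forall>\<^sub>F t in at_right 0. \<forall>u. nonneg_supersolution \<Omega> lam Lam t u \<longrightarrow> (\<forall>x\<in>B. 1 \<le> u x)
        \<longrightarrow> (\<forall>x\<in>S. t * w x \<le> u x))"

lemma lower_bound_subset: "lower_bound B w S \<Longrightarrow> S' \<subseteq> S \<Longrightarrow> lower_bound B w S'"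
  unfolding lower_bound_def by (erule eventually_mono) blast

lemma lower_bound_locally_to_globally:
  assumes "compact K" "S \<subseteq> K"
    and loc: "\<And>p. p \<in> K \<Longrightarrow> \<exists>s>0. lower_bound B w (ball p s \<inter> S)"
  shows "lower_bound B w S"
proof -
  obtain s where s: "\<And>p. p \<in> K \<Longrightarrow> 0 < s p \<and> lower_bound B w (ball p (s p) \<inter> S)"
    using loc by metis
  then have "K \<subseteq> (\<Union>p\<in>K. ball p (s p))" by fastforce
  then obtain D where D: "D \<subseteq> K" "finite D" "K \<subseteq> (\<Union>p\<in>D. ball p (s p))"
    by (rule compactE_image[OF \<open>compact K\<close> open_ball])
  have "\<forall>\<^sub>F t in at_right 0. \<forall>p\<in>D. \<forall>u. nonneg_supersolution \<Omega> lam Lam t u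
      \<longrightarrow> (\<forall>x\<in>B. 1 \<le> u x) \<longrightarrow> (\<forall>x\<in>ball p (s p) \<inter> S. t * w x \<le> u x)"
    using D s by (intro eventually_ball_finite) (auto simp: lower_bound_def)
  then show ?thesis
    unfolding lower_bound_def
  proof eventually_elim
    case (elim t)
    then show ?case using D(3) \<open>S \<subseteq> K\<close> by blast
  qed
qed

text \<open>The barrier in terms of shared bounds: a bound on the small balls of a family, all of the same
  radii but with arbitrary centres, passes to weights controlled by the distance to the sphere
  of the large balls. The set \<open>S\<close> may need infinitely many centres.\<close>
lemma lower_bound_spreads:
  assumes K: "lower_bound B (\<lambda>_. 1) K" and r: "0 < r" "r < R" and "0 < C"
    and S: "\<And>x. x \<in> S \<Longrightarrow> \<exists>y. ball y r \<subseteq> K \<and> ball y R \<subseteq> \<Omega> \<and> x \<in> ball y R \<and> w x \<le> C * (R - dist x y)"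
  shows "lower_bound B w S"
proof -
  obtain \<kappa> where "0 < \<kappa>" and \<kappa>:
    "\<And>(\<Omega> :: (real^'n) set) u m \<epsilon> y x. \<lbrakk>open \<Omega>; nonneg_supersolution \<Omega> lam Lam \<epsilon> u;
       ball y R \<subseteq> \<Omega>; 0 < m; \<And>w. w \<in> ball y r \<Longrightarrow> m \<le> u w; \<epsilon> \<le> \<kappa> * m; x \<in> ball y R\<rbrakk>
     \<Longrightarrow> \<kappa> * m * (R - dist x y) \<le> u x"
    using supersolution_spreads[OF lam_pos Lam_pos r] by metis
  have "\<forall>\<^sub>F t in at_right (0::real). 0 < t" by (rule eventually_at_right_less)
  then have "\<forall>\<^sub>F t in at_right 0. 0 < t \<and> (\<forall>u. nonneg_supersolution \<Omega> lam Lam t u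
      \<longrightarrow> (\<forall>x\<in>B. 1 \<le> u x) \<longrightarrow> (\<forall>x\<in>K. t * 1 \<le> u x))"
    using K unfolding lower_bound_def by (rule eventually_conj)
  then obtain m where "0 < m \<and> (\<forall>u. nonneg_supersolution \<Omega> lam Lam m u
      \<longrightarrow> (\<forall>x\<in>B. 1 \<le> u x) \<longrightarrow> (\<forall>x\<in>K. m * 1 \<le> u x))"
    using eventually_happens'[OF trivial_limit_at_right_real] by blast
  then have "0 < m" and m: "\<And>u x. \<lbrakk>nonneg_supersolution \<Omega> lam Lam m u;
      \<And>x. x \<in> B \<Longrightarrow> 1 \<le> u x; x \<in> K\<rbrakk> \<Longrightarrow> m \<le> u x"
    by simp_all
  define T where "T = min m (min (\<kappa> * m) (\<kappa> * m / C))"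
  have "0 < T" using \<open>0 < m\<close> \<open>0 < \<kappa>\<close> \<open>0 < C\<close> by (simp add: T_def)
  moreover have "t * w x \<le> u x"
    if t: "0 < t" "t < T" and u: "nonneg_supersolution \<Omega> lam Lam t u"
      and B: "\<And>x. x \<in> B \<Longrightarrow> 1 \<le> u x" and x: "x \<in> S" for t u x
  proof -
    obtain y where y: "ball y r \<subseteq> K" "ball y R \<subseteq> \<Omega>" "x \<in> ball y R" "w x \<le> C * (R - dist x y)"
      using S[OF x] by blast
    have d: "0 \<le> R - dist x y" using y by (simp add: dist_commute)
    have tT: "t \<le> m" "t \<le> \<kappa> * m" "t * C \<le> \<kappa> * m"
      using t \<open>0 < C\<close> by (auto simp: T_def field_simps)
    have "m \<le> u v" if "v \<in> ball y r" for v
      using m[OF nonneg_supersolution_mono[OF u tT(1)] B] that y by blast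
    then have "\<kappa> * m * (R - dist x y) \<le> u x"
      by (intro \<kappa>[OF open_domain u y(2) \<open>0 < m\<close> _ tT(2) y(3)])
    moreover have "t * w x \<le> (t * C) * (R - dist x y)"
      using mult_left_mono[OF y(4), of t] t by (simp add: mult_ac)
    moreover have "(t * C) * (R - dist x y) \<le> \<kappa> * m * (R - dist x y)"
      using tT d by (intro mult_right_mono)
    ultimately show ?thesis by linarith
  qed
  ultimately show ?thesis
    unfolding lower_bound_def eventually_at_right_field by blast
qed

text \<open>The gain over spreading from \<open>ball q r\<close> is that the new radius depends only on \<open>d\<close>, the room around
  \<open>p\<close>, and not on \<open>r\<close>; this makes the set of good points relatively closed. The ball of radius \<open>d / 2\<close>
  around \<open>q\<close> still lies in \<open>ball p d\<close> and contains \<open>ball p (d / 8)\<close> at depth at least \<open>d / 8\<close>, whence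
  the factor \<open>8 / d\<close>.\<close>
lemma lower_bound_nearby:
  assumes q: "lower_bound B (\<lambda>_. 1) (ball q r)" "0 < r" and "0 < d" "ball p d \<subseteq> \<Omega>" "dist p q < d / 4"
  shows "lower_bound B (\<lambda>_. 1) (ball p (d / 8))"
proof (rule lower_bound_spreads[where r = "min r (d / 4)" and R = "d / 2" and C = "8 / d"])
  fix x assume x: "x \<in> ball p (d / 8)"
  have "dist x q < 3 * d / 8"
    using x assms dist_triangle[of x q p] by (simp add: dist_commute)
  then have "1 \<le> 8 / d * (d / 2 - dist x q)" "dist q x < d / 2"
    using \<open>0 < d\<close> by (simp_all add: dist_commute field_simps)
  moreover have "ball q (d / 2) \<subseteq> ball p d"
    using assms by (simp add: ball_subset_ball_iff dist_commute)
  ultimately show "\<exists>y. ball y (min r (d / 4)) \<subseteq> ball q r \<and> ball y (d / 2) \<subseteq> \<Omega> \<and> x \<in> ball y (d / 2)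
      \<and> 1 \<le> 8 / d * (d / 2 - dist x y)"
    using assms by (intro exI[of _ q]) auto
qed (use assms in auto)

text \<open>The centres \<open>p\<close> for which the claim holds form an open set \<open>A\<close>, and so do the other points of the
  domain.\<close>
lemma lower_bound_ball:
  assumes "connected \<Omega>" "z \<in> \<Omega>" "0 < s" "p \<in> \<Omega>"
  shows "\<exists>r>0. lower_bound (ball z s) (\<lambda>_. 1) (ball p r)"
proof -
  define A where "A = {p \<in> \<Omega>. \<exists>r>0. lower_bound (ball z s) (\<lambda>_. 1) (ball p r)}"
  have "\<exists>d>0. ball p d \<subseteq> A" if p: "p \<in> A" for p
  proof -
    obtain r where r: "0 < r" "lower_bound (ball z s) (\<lambda>_. 1) (ball p r)"
      using p by (auto simp: A_def)
    obtain d where d: "0 < d" "ball p d \<subseteq> \<Omega>"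
      using p by (auto simp: A_def intro: openE[OF open_domain])
    have "q \<in> A" if "q \<in> ball p (min d (r / 2))" for q
    proof -
      have "ball q (r / 2) \<subseteq> ball p r"
        using that by (simp add: ball_subset_ball_iff dist_commute)
      then show ?thesis
        using lower_bound_subset[OF r(2)] d r that unfolding A_def
        by (auto intro!: exI[of _ "r / 2"])
    qed
    then show ?thesis using d r by (intro exI[of _ "min d (r / 2)"]) auto
  qed
  then have openA: "open A" using open_contains_ball by blast
  have "\<exists>d>0. ball p d \<subseteq> \<Omega> - A" if p: "p \<in> \<Omega> - A" for p
  proof -
    obtain d where d: "0 < d" "ball p d \<subseteq> \<Omega>"
      using p by (auto intro: openE[OF open_domain])
    have "q \<notin> A" if "q \<in> ball p (d / 4)" for q
      using lower_bound_nearby[of "ball z s" q _ d p] d p that unfolding A_def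
      by (auto dest!: spec[of _ "d / 8"])
    then show ?thesis
      using d by (intro exI[of _ "d / 4"]) auto
  qed
  then have openB: "open (\<Omega> - A)" using open_contains_ball by blast
  have "lower_bound (ball z s) (\<lambda>_. 1) (ball z s)"
    unfolding lower_bound_def eventually_at_right_field
    by (intro exI[of _ 1]) force
  then have "z \<in> A" using assms by (auto simp: A_def)
  then have "(\<Omega> - A) \<inter> \<Omega> = {}"
    using connectedD[OF \<open>connected \<Omega>\<close> openA openB] \<open>z \<in> \<Omega>\<close> by blast
  then show ?thesis using \<open>p \<in> \<Omega>\<close> by (auto simp: A_def)
qed

lemma lower_bound_compact:
  assumes "connected \<Omega>" "z \<in> \<Omega>" "0 < s" "compact K" "K \<subseteq> \<Omega>"
  shows "lower_bound (ball z s) (\<lambda>_. 1) K"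
proof (rule lower_bound_locally_to_globally[OF \<open>compact K\<close> order_refl])
  fix p assume "p \<in> K"
  then obtain r where "0 < r" "lower_bound (ball z s) (\<lambda>_. 1) (ball p r)"
    using lower_bound_ball[OF assms(1-3)] \<open>K \<subseteq> \<Omega>\<close> by blast
  then show "\<exists>r>0. lower_bound (ball z s) (\<lambda>_. 1) (ball p r \<inter> K)"
    using lower_bound_subset[OF _ Int_lower1] by blast
qed

end

text \<open>The set is an intersection of the closed sets of points at distance at least \<open>r\<close> from a given
  point of the complement.\<close>
lemma compact_inner_parallel_set:
  fixes \<Omega> :: "(real^'n::finite) set"
  assumes "bounded \<Omega>" "0 < r"
  shows "compact {w. ball w r \<subseteq> \<Omega>}"
proof -
  have "{w. ball w r \<subseteq> \<Omega>} = (\<Inter>v\<in>-\<Omega>. {w. r \<le> dist w v})"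
    by (auto simp: subset_eq not_less[symmetric])
  moreover have "closed (\<Inter>v\<in>-\<Omega>. {w. r \<le> dist w v})"
    by (intro closed_INT ballI closed_Collect_le continuous_intros)
  moreover have "{w. ball w r \<subseteq> \<Omega>} \<subseteq> \<Omega>" using \<open>0 < r\<close> by auto
  ultimately show ?thesis
    using bounded_subset[OF \<open>bounded \<Omega>\<close>] by (simp add: compact_eq_bounded_closed)
qed

section \<open>Interior spheres at a \<open>C\<^sup>2\<close> boundary\<close>

lemma has_derivative_gradient:
  fixes f :: "real^'n::finite \<Rightarrow> real"
  assumes "f differentiable (at x)"
  shows "(f has_derivative (\<lambda>h. (\<chi> i. partial_deriv i f x) \<bullet> h)) (at x)"
proof -
  define D where "D = frechet_derivative f (at x)"
  have D: "(f has_derivative D) (at x)"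
    using assms by (simp add: D_def frechet_derivative_works[symmetric])
  have "D h = (\<chi> i. partial_deriv i f x) \<bullet> h" for h
  proof -
    have "D h = D (\<Sum>i\<in>UNIV. h $ i *\<^sub>R axis i 1)"
      by (simp add: basis_expansion flip: scalar_mult_eq_scaleR)
    also have "\<dots> = (\<Sum>i\<in>UNIV. h $ i * D (axis i 1))"
      using has_derivative_linear[OF D] by (simp add: linear_sum linear_cmul)
    also have "\<dots> = (\<chi> i. partial_deriv i f x) \<bullet> h"
      by (simp add: inner_vec_def partial_deriv_def D_def mult.commute)
    finally show ?thesis .
  qed
  then show ?thesis using D by (metis ext)
qed

lemma abs_diff_le_gradient_bound:
  fixes f :: "real^'n::finite \<Rightarrow> real"
  assumes "convex S"
    and "\<And>w. w \<in> S \<Longrightarrow> (f has_derivative (\<lambda>h. F w \<bullet> h)) (at w)"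
    and "\<And>w. w \<in> S \<Longrightarrow> norm (F w) \<le> B" and "x \<in> S" "y \<in> S"
  shows "\<bar>f y - f x\<bar> \<le> B * norm (y - x)"
proof -
  have "onorm (\<lambda>h. F w \<bullet> h) \<le> B" if "w \<in> S" for w
  proof (rule onorm_le)
    fix h
    have "norm (F w \<bullet> h) \<le> norm (F w) * norm h" by (simp add: Cauchy_Schwarz_ineq2)
    also have "\<dots> \<le> B * norm h" using assms(3)[OF that] by (simp add: mult_right_mono)
    finally show "norm (F w \<bullet> h) \<le> B * norm h" .
  qed
  then show ?thesis
    using differentiable_bound[OF \<open>convex S\<close> has_derivative_at_withinI[OF assms(2)], of B y x] assms
    by auto
qed

text \<open>The second derivatives are bounded on a compact ball, so each component of the gradient is
  Lipschitz there. The remainder bound follows by applying the mean value inequality to \<open>f\<close> minus its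
  linear part on the segment from \<open>x\<close> to \<open>y\<close>.\<close>
lemma C2_taylor:
  fixes f :: "real^'n::finite \<Rightarrow> real"
  assumes f: "C2_on UNIV f"
  obtains G C where "0 < C"
    "\<And>x. (f has_derivative (\<lambda>h. G x \<bullet> h)) (at x)"
    "\<And>x. x \<in> cball p r \<Longrightarrow> norm (G x) \<le> C"
    "\<And>x y. \<lbrakk>x \<in> cball p r; y \<in> cball p r\<rbrakk> \<Longrightarrow> \<bar>f y - f x - G x \<bullet> (y - x)\<bar> \<le> C * (norm (y - x))\<^sup>2"
proof -
  define G where "G x = (\<chi> i. partial_deriv i f x)" for x
  define H where "H i x = (\<chi> j. partial_deriv j (partial_deriv i f) x)" for i x
  have dG: "(f has_derivative (\<lambda>h. G x \<bullet> h)) (at x)" for x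
    using f has_derivative_gradient[of f x] by (auto simp: C2_on_def G_def)
  have dH: "((\<lambda>x. G x $ i) has_derivative (\<lambda>h. H i x \<bullet> h)) (at x)" for i x
    using f has_derivative_gradient[of "partial_deriv i f" x] by (auto simp: C2_on_def G_def H_def)
  have "continuous_on UNIV (H i)" for i
    unfolding H_def
    using f by (intro continuous_on_vec_lambda) (simp add: C2_on_def)
  then have "bounded (H i ` cball p r)" for i
    by (intro compact_imp_bounded compact_continuous_image compact_cball) (blast intro: continuous_on_subset)
  then have "\<exists>M. \<forall>x\<in>cball p r. norm (H i x) \<le> M" for i by (auto simp: bounded_iff)
  then obtain M where M: "\<And>i x. x \<in> cball p r \<Longrightarrow> norm (H i x) \<le> M i" by metis
  define L where "L = (\<Sum>i\<in>UNIV. M i)"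
  have lip: "norm (G y - G x) \<le> L * norm (y - x)" if "x \<in> cball p r" "y \<in> cball p r" for x y
  proof -
    have "\<bar>(G y - G x) $ i\<bar> \<le> M i * norm (y - x)" for i
      using abs_diff_le_gradient_bound[OF convex_cball dH M that] by simp
    then have "(\<Sum>i\<in>UNIV. \<bar>(G y - G x) $ i\<bar>) \<le> (\<Sum>i\<in>UNIV. M i * norm (y - x))"
      by (rule sum_mono)
    then show ?thesis
      using norm_le_l1_cart[of "G y - G x"] by (simp add: L_def sum_distrib_right)
  qed
  have "continuous_on UNIV G"
    unfolding continuous_on_eq_continuous_at[OF open_UNIV]
  proof (intro ballI)
    fix x
    have "isCont (\<lambda>x. \<chi> i. G x $ i) x"
      using has_derivative_continuous[OF dH] unfolding continuous_at
      by (intro tendsto_vec_lambda) auto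
    then show "isCont G x" by simp
  qed
  then have "bounded (G ` cball p r)"
    by (intro compact_imp_bounded compact_continuous_image compact_cball) (blast intro: continuous_on_subset)
  then have "\<exists>A. \<forall>x\<in>cball p r. norm (G x) \<le> A" by (auto simp: bounded_iff)
  then obtain A where A: "\<And>x. x \<in> cball p r \<Longrightarrow> norm (G x) \<le> A" by blast
  define C where "C = max 1 (max A L)"
  have LC: "L \<le> C" by (simp add: C_def)
  have taylor: "\<bar>f y - f x - G x \<bullet> (y - x)\<bar> \<le> C * (norm (y - x))\<^sup>2"
    if "x \<in> cball p r" "y \<in> cball p r" for x y
  proof -
    have seg: "closed_segment x y \<subseteq> cball p r"
      using that by (simp add: closed_segment_subset)
    have d: "((\<lambda>w. f w - G x \<bullet> w) has_derivative (\<lambda>h. (G w - G x) \<bullet> h)) (at w)" for w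
      using has_derivative_diff[OF dG has_derivative_inner_right[OF has_derivative_ident]]
      by (simp add: inner_diff_left)
    have "norm (G w - G x) \<le> C * norm (y - x)" if "w \<in> closed_segment x y" for w
    proof -
      have "norm (G w - G x) \<le> L * norm (w - x)" using lip that seg \<open>x \<in> cball p r\<close> by blast
      also have "\<dots> \<le> C * norm (w - x)" using LC by (simp add: mult_right_mono)
      also have "\<dots> \<le> C * norm (y - x)"
        using segment_bound(1)[OF that] by (intro mult_left_mono) (auto simp: C_def)
      finally show ?thesis .
    qed
    then have "\<bar>(f y - G x \<bullet> y) - (f x - G x \<bullet> x)\<bar> \<le> C * norm (y - x) * norm (y - x)"
      by (intro abs_diff_le_gradient_bound[OF convex_closed_segment d]) auto
    then show ?thesis by (simp add: inner_diff_right power2_eq_square algebra_simps)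
  qed
  show thesis
  proof (rule that[of C G])
    show "norm (G x) \<le> C" if "x \<in> cball p r" for x using A[OF that] by (simp add: C_def)
  qed (use dG taylor in \<open>auto simp: C_def\<close>)
qed

text \<open>The segment from \<open>x\<close> to \<open>y\<close> meets the frontier.\<close>
lemma infdist_frontier_le_dist:
  fixes x y :: "'a::real_normed_vector"
  assumes "x \<in> \<Omega>" "y \<notin> \<Omega>"
  shows "infdist x (frontier \<Omega>) \<le> dist x y"
proof -
  obtain w where w: "w \<in> closed_segment x y" "w \<in> frontier \<Omega>"
    using connected_Int_frontier[of "closed_segment x y" \<Omega>] assms by auto
  have "infdist x (frontier \<Omega>) \<le> dist x w" using w by (simp add: infdist_le)
  also have "\<dots> \<le> dist x y" using segment_bound(1)[OF w(1)] by (simp add: dist_norm norm_minus_commute)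
  finally show ?thesis .
qed

text \<open>Near \<open>p\<close> the domain is \<open>{g > 0}\<close> with \<open>g w = w \<bullet> \<nu> - \<gamma> w\<close>. A point \<open>x\<close> is moved by \<open>t = g x\<close> against
  \<open>\<nu>\<close> to the boundary point \<open>q\<close>, so its distance to the boundary is at most \<open>t\<close>. The ball of radius
  \<open>\<rho>\<close> touching the boundary at \<open>q\<close> along the inner normal \<open>N = \<nu> - \<nabla>\<gamma>(q)\<close> stays in the domain when
  \<open>2 \<rho> C \<le> 1\<close>, because on it \<open>2 \<rho> (w - q) \<bullet> N\<close> exceeds \<open>|w - q|\<^sup>2\<close>, which beats the Taylor remainder.
  Since \<open>\<nu>\<close> and \<open>N\<close> make an angle bounded away from a right angle, \<open>x\<close> lies at depth comparable to \<open>t\<close>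
  in that ball.\<close>
lemma interior_sphere:
  fixes \<Omega> :: "(real^'n::finite) set"
  assumes "open \<Omega>" "has_C2_boundary \<Omega>" and p: "p \<in> frontier \<Omega>"
  obtains s \<rho> C where "0 < s" "0 < \<rho>" "0 < C"
    "\<And>x. x \<in> ball p s \<inter> \<Omega> \<Longrightarrow>
       \<exists>y. ball y \<rho> \<subseteq> \<Omega> \<and> x \<in> ball y \<rho> \<and> infdist x (frontier \<Omega>) \<le> C * (\<rho> - dist x y)"
proof -
  obtain r \<nu> \<gamma> where "0 < r" and \<nu>: "norm \<nu> = 1" and C2: "C2_on UNIV \<gamma>"
    and \<gamma>\<nu>: "\<And>x t. \<gamma> (x + t *\<^sub>R \<nu>) = \<gamma> x"
    and \<Omega>: "\<Omega> \<inter> ball p r = {x \<in> ball p r. \<gamma> x < x \<bullet> \<nu>}"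
    using bspec[OF assms(2)[unfolded has_C2_boundary_def] p] by blast
  obtain G C where "0 < C" and dG: "\<And>x. (\<gamma> has_derivative (\<lambda>h. G x \<bullet> h)) (at x)"
    and GC: "\<And>x. x \<in> cball p r \<Longrightarrow> norm (G x) \<le> C"
    and taylor: "\<And>x y. \<lbrakk>x \<in> cball p r; y \<in> cball p r\<rbrakk>
        \<Longrightarrow> \<bar>\<gamma> y - \<gamma> x - G x \<bullet> (y - x)\<bar> \<le> C * (norm (y - x))\<^sup>2"
    by (rule C2_taylor[OF C2, where p = p and r = r]) (rule that)
  have G\<nu>: "G x \<bullet> \<nu> = 0" for x
  proof -
    have "((\<lambda>t::real. \<gamma> (x + t *\<^sub>R \<nu>)) has_derivative (\<lambda>t. G x \<bullet> (t *\<^sub>R \<nu>))) (at 0)"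
      by (rule has_derivative_compose[of "\<lambda>t. x + t *\<^sub>R \<nu>" _ 0 UNIV \<gamma>, simplified])
        (auto intro!: derivative_eq_intros dG)
    then have "((\<lambda>t::real. \<gamma> x) has_derivative (\<lambda>t. G x \<bullet> (t *\<^sub>R \<nu>))) (at 0)"
      by (simp add: \<gamma>\<nu>)
    from has_derivative_unique[OF this has_derivative_const]
    have "(\<lambda>t::real. G x \<bullet> (t *\<^sub>R \<nu>)) = (\<lambda>_. 0)" .
    from fun_cong[OF this, of 1] show ?thesis by simp
  qed
  define g where "g w = w \<bullet> \<nu> - \<gamma> w" for w
  have in\<Omega>: "w \<in> \<Omega> \<longleftrightarrow> 0 < g w" if "w \<in> ball p r" for w
  proof -
    have "w \<in> \<Omega> \<inter> ball p r \<longleftrightarrow> w \<in> {x \<in> ball p r. \<gamma> x < x \<bullet> \<nu>}" by (simp only: \<Omega>)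
    then show ?thesis using that by (simp add: g_def)
  qed
  have contg: "isCont g w" for w
    unfolding g_def by (intro continuous_intros has_derivative_continuous[OF dG])
  \<comment> \<open>\<open>p\<close> is not in the open set \<open>\<Omega>\<close>, and it is a limit of points of \<open>\<Omega>\<close>.\<close>
  have gp: "g p = 0"
  proof (rule antisym)
    have "p \<notin> \<Omega>" using p \<open>open \<Omega>\<close> by (simp add: frontier_def interior_open)
    then show "g p \<le> 0" using in\<Omega>[of p] \<open>0 < r\<close> by simp
    show "0 \<le> g p"
    proof (rule ccontr)
      assume "\<not> ?thesis"
      define V where "V = ball p r \<inter> {w. g w < 0}"
      have "open {w. g w < 0}"
        using contg by (intro open_Collect_less) (auto intro: continuous_at_imp_continuous_on)
      then have "open V" unfolding V_def by auto
      moreover have "V \<inter> \<Omega> = {}" using in\<Omega> by (auto simp: V_def)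
      moreover have "p \<in> V \<inter> closure \<Omega>"
        using \<open>\<not> 0 \<le> g p\<close> \<open>0 < r\<close> p by (simp add: V_def frontier_def)
      ultimately show False using open_Int_closure_eq_empty by blast
    qed
  qed
  define M where "M = 1 + C"
  define \<rho> where "\<rho> = min (1 / (2 * C)) (r / 4)"
  have M: "0 < M" and \<rho>: "0 < \<rho>" and \<rho>r: "\<rho> \<le> r / 4"
    using \<open>0 < C\<close> \<open>0 < r\<close> by (auto simp: M_def \<rho>_def)
  have "\<rho> \<le> 1 / (2 * C)" by (simp add: \<rho>_def)
  then have \<rho>C: "2 * \<rho> * C \<le> 1" using \<open>0 < C\<close> by (simp add: field_simps)
  have "0 < min (r / 4) (\<rho> / M)" using M \<rho> \<open>0 < r\<close> by simp
  \<comment> \<open>\<open>r / 4\<close> keeps \<open>q\<close> and the touching ball inside \<open>ball p r\<close>; \<open>\<rho> / M\<close> makes \<open>t\<close> at most half the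
    length of the chord through \<open>q\<close> in direction \<open>\<nu>\<close>.\<close>
  then obtain s0 where s0: "0 < s0" "\<And>x. dist x p < s0 \<Longrightarrow> \<bar>g x\<bar> < min (r / 4) (\<rho> / M)"
    using contg[of p] gp unfolding continuous_at_eps_delta dist_real_def by (metis diff_zero)
  define s where "s = min s0 (r / 4)"
  have main: "\<exists>y. ball y \<rho> \<subseteq> \<Omega> \<and> x \<in> ball y \<rho> \<and> infdist x (frontier \<Omega>) \<le> 2 * M * (\<rho> - dist x y)"
    if "x \<in> ball p s \<inter> \<Omega>" for x
  proof -
    define t where "t = g x"
    have x: "dist x p < s0" "dist x p < r / 4" "x \<in> \<Omega>" using that by (auto simp: s_def dist_commute)
    have "x \<in> ball p r" using x \<open>0 < r\<close> by (simp add: dist_commute)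
    then have t: "0 < t" "t < r / 4" "t < \<rho> / M"
      using s0(2)[OF x(1)] in\<Omega> x by (auto simp: t_def)
    define q where "q = x - t *\<^sub>R \<nu>"
    have "\<gamma> q = \<gamma> x" using \<gamma>\<nu>[of x "- t"] by (simp add: q_def)
    then have gq: "g q = 0"
      using \<nu> by (simp add: g_def t_def q_def inner_diff_left power2_norm_eq_inner[symmetric])
    have dq: "dist x q = t" using t \<nu> by (simp add: q_def dist_norm)
    have qp: "dist p q < r / 2"
      using dist_triangle[of p q x] x dq t by (simp add: dist_commute)
    have qr: "q \<in> ball p r" using qp \<open>0 < r\<close> by simp
    then have "q \<notin> \<Omega>" using in\<Omega> gq by simp
    then have inf: "infdist x (frontier \<Omega>) \<le> t"
      using infdist_frontier_le_dist[OF x(3)] dq by metis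
    define N where "N = \<nu> - G q"
    define n where "n = norm N"
    have \<nu>N: "\<nu> \<bullet> N = 1"
      using G\<nu>[of q] \<nu> by (simp add: N_def inner_diff_right inner_commute power2_norm_eq_inner[symmetric])
    have n1: "1 \<le> n"
      using norm_cauchy_schwarz[of \<nu> N] \<nu>N \<nu> by (simp add: n_def)
    have nM: "n \<le> M"
      using norm_triangle_ineq4[of \<nu> "G q"] GC[of q] qr \<nu> by (simp add: n_def N_def M_def)
    define y where "y = q + (\<rho> / n) *\<^sub>R N"
    have sq: "(norm (v - (\<rho> / n) *\<^sub>R N))\<^sup>2 = (norm v)\<^sup>2 - 2 * (\<rho> / n) * (v \<bullet> N) + \<rho>\<^sup>2" for v
    proof -
      have "(norm (v - w))\<^sup>2 = (norm v)\<^sup>2 - 2 * (v \<bullet> w) + (norm w)\<^sup>2" for w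
        by (simp add: power2_norm_eq_inner inner_diff_left inner_diff_right inner_commute)
      moreover have "norm ((\<rho> / n) *\<^sub>R N) = \<rho>" using n1 \<rho> by (auto simp: n_def)
      ultimately show ?thesis by simp
    qed
    have "w \<in> \<Omega>" if w: "w \<in> ball y \<rho>" for w
    proof -
      have "dist q y = \<rho>" using n1 \<rho> by (auto simp: y_def dist_norm n_def)
      then have "w \<in> ball p r"
        using w qp \<rho>r dist_triangle[of p w q] dist_triangle[of q w y] by simp
      define v where "v = w - q"
      have "norm (v - (\<rho> / n) *\<^sub>R N) < \<rho>"
        using w by (simp add: v_def y_def dist_norm norm_minus_commute algebra_simps)
      then have "(norm (v - (\<rho> / n) *\<^sub>R N))\<^sup>2 < \<rho>\<^sup>2" by (simp add: power_strict_mono)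
      then have "(norm v)\<^sup>2 < 2 * (\<rho> / n) * (v \<bullet> N)" by (simp add: sq)
      then have "n * (norm v)\<^sup>2 < 2 * \<rho> * (v \<bullet> N)" using n1 by (simp add: field_simps)
      moreover have "1 * (norm v)\<^sup>2 \<le> n * (norm v)\<^sup>2" using n1 by (intro mult_right_mono) auto
      moreover have "2 * \<rho> * C * (norm v)\<^sup>2 \<le> 1 * (norm v)\<^sup>2" using \<rho>C by (intro mult_right_mono) auto
      ultimately have "2 * \<rho> * (C * (norm v)\<^sup>2) < 2 * \<rho> * (v \<bullet> N)" by (simp add: mult_ac)
      then have "C * (norm v)\<^sup>2 < v \<bullet> N" using \<rho> by simp
      moreover have "\<gamma> w - \<gamma> q - G q \<bullet> v \<le> C * (norm v)\<^sup>2"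
        using taylor[of q w] qr \<open>w \<in> ball p r\<close> by (simp add: v_def)
      moreover have "g w = v \<bullet> \<nu> - (\<gamma> w - \<gamma> q)"
        using gq by (simp add: g_def v_def inner_diff_left)
      ultimately have "0 < g w" by (simp add: N_def inner_diff_right inner_commute)
      then show ?thesis using in\<Omega> \<open>w \<in> ball p r\<close> by simp
    qed
    moreover
    define d where "d = dist x y"
    have "x - y = t *\<^sub>R \<nu> - (\<rho> / n) *\<^sub>R N" by (simp add: y_def q_def)
    then have d2: "d\<^sup>2 = t\<^sup>2 - 2 * (\<rho> / n) * t + \<rho>\<^sup>2"
      using sq[of "t *\<^sub>R \<nu>"] t \<nu> \<nu>N by (simp add: d_def dist_norm)
    have "\<rho> / M \<le> \<rho> / n" using nM n1 \<rho> by (simp add: frac_le)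
    then have "t * (\<rho> / M) + t * t \<le> t * (\<rho> / n) + t * (\<rho> / n)"
      using t by (intro add_mono mult_left_mono) auto
    then have d3: "t * (\<rho> / M) \<le> \<rho>\<^sup>2 - d\<^sup>2" unfolding d2 by (simp add: power2_eq_square algebra_simps)
    have "0 < t * (\<rho> / M)" using t \<rho> M by simp
    then have "d\<^sup>2 < \<rho>\<^sup>2" using d3 by linarith
    then have d\<rho>: "d < \<rho>" using \<rho> by (simp add: power2_less_imp_less)
    moreover have "t \<le> 2 * M * (\<rho> - d)"
    proof -
      have "\<rho>\<^sup>2 - d\<^sup>2 = (\<rho> - d) * (\<rho> + d)" by (simp add: power2_eq_square algebra_simps)
      also have "\<dots> \<le> (\<rho> - d) * (2 * \<rho>)" using d\<rho> by (intro mult_left_mono) auto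
      finally have "t * (\<rho> / M) \<le> (\<rho> - d) * (2 * \<rho>)" using d3 by linarith
      then have "\<rho> * t \<le> \<rho> * (2 * M * (\<rho> - d))" using M by (simp add: field_simps)
      then show ?thesis using \<rho> by simp
    qed
    ultimately show ?thesis
      using inf by (intro exI[of _ y]) (auto simp: d_def dist_commute)
  qed
  show thesis
    by (rule that[of s \<rho> "2 * M"]) (use main s0 \<open>0 < r\<close> \<rho> M in \<open>auto simp: s_def\<close>)
qed

section \<open>The bound by the distance to the boundary\<close>

text \<open>The centres \<open>y\<close> of the interior spheres vary with \<open>x\<close>, but the balls of half the radius around
  them all lie in one compact subset \<open>K\<close> of the domain, where a positive lower bound is available.\<close>
lemma (in elliptic_class) lower_bound_near_frontier:
  assumes "connected \<Omega>" "bounded \<Omega>" "has_C2_boundary \<Omega>" "z \<in> \<Omega>" "0 < s" "p \<in> frontier \<Omega>"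
  shows "\<exists>r>0. lower_bound (ball z s) (\<lambda>x. infdist x (frontier \<Omega>)) (ball p r \<inter> \<Omega>)"
proof -
  obtain r \<rho> C where *: "0 < r" "0 < \<rho>" "0 < C"
    "\<And>x. x \<in> ball p r \<inter> \<Omega> \<Longrightarrow>
       \<exists>y. ball y \<rho> \<subseteq> \<Omega> \<and> x \<in> ball y \<rho> \<and> infdist x (frontier \<Omega>) \<le> C * (\<rho> - dist x y)"
    using interior_sphere[OF open_domain \<open>has_C2_boundary \<Omega>\<close> \<open>p \<in> frontier \<Omega>\<close>] by metis
  define K where "K = {w. ball w (\<rho> / 2) \<subseteq> \<Omega>}"
  have "compact K" "K \<subseteq> \<Omega>"
    using compact_inner_parallel_set[OF \<open>bounded \<Omega>\<close>, of "\<rho> / 2"] *(2) by (auto simp: K_def)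
  then have K: "lower_bound (ball z s) (\<lambda>_. 1) K"
    using assms by (intro lower_bound_compact)
  have sub: "ball y (\<rho> / 2) \<subseteq> K" if "ball y \<rho> \<subseteq> \<Omega>" for y
  proof
    fix w assume "w \<in> ball y (\<rho> / 2)"
    then have "ball w (\<rho> / 2) \<subseteq> ball y \<rho>" by (simp add: ball_subset_ball_iff dist_commute)
    then show "w \<in> K" using that by (auto simp: K_def)
  qed
  have "lower_bound (ball z s) (\<lambda>x. infdist x (frontier \<Omega>)) (ball p r \<inter> \<Omega>)"
    using * sub by (intro lower_bound_spreads[OF K, of "\<rho> / 2" \<rho> C]) (simp_all, blast)
  then show ?thesis using \<open>0 < r\<close> by blast
qed

lemma (in elliptic_class) lower_bound_infdist_frontier:
  assumes "connected \<Omega>" "bounded \<Omega>" "has_C2_boundary \<Omega>" "z \<in> \<Omega>" "0 < s"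
  shows "lower_bound (ball z s) (\<lambda>x. infdist x (frontier \<Omega>)) \<Omega>"
proof (rule lower_bound_locally_to_globally)
  show "compact (closure \<Omega>)" using \<open>bounded \<Omega>\<close> by (simp add: compact_closure)
  show "\<Omega> \<subseteq> closure \<Omega>" by (rule closure_subset)
  fix p assume "p \<in> closure \<Omega>"
  then consider "p \<in> frontier \<Omega>" | "p \<in> \<Omega>"
    using open_domain by (auto simp: frontier_def interior_open)
  then show "\<exists>r>0. lower_bound (ball z s) (\<lambda>x. infdist x (frontier \<Omega>)) (ball p r \<inter> \<Omega>)"
  proof cases
    case 1
    then show ?thesis using lower_bound_near_frontier assms by blast
  next
    case 2
    obtain d where d: "0 < d" "ball p d \<subseteq> \<Omega>" using 2 openE[OF open_domain] by blast
    \<comment> \<open>Away from the boundary the distance is merely bounded: by \<open>D\<close> near \<open>p\<close>.\<close>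
    define D where "D = infdist p (frontier \<Omega>) + d"
    have D: "0 < D" using d infdist_nonneg[of p "frontier \<Omega>"] by (simp add: D_def)
    have "compact (cball p (d / 2))" "cball p (d / 2) \<subseteq> \<Omega>" using d by auto
    then have K: "lower_bound (ball z s) (\<lambda>_. 1) (cball p (d / 2))"
      using assms by (intro lower_bound_compact)
    have "lower_bound (ball z s) (\<lambda>x. infdist x (frontier \<Omega>)) (ball p (d / 4))"
    proof (rule lower_bound_spreads[OF K, of "d / 4" "d / 2" "4 * D / d"])
      fix x assume x: "x \<in> ball p (d / 4)"
      have "infdist x (frontier \<Omega>) \<le> D"
        using infdist_triangle[of x "frontier \<Omega>" p] x d by (simp add: D_def dist_commute)
      moreover have "D * 1 \<le> D * (4 / d * (d / 2 - dist x p))"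
        using x d D by (intro mult_left_mono) (auto simp: field_simps dist_commute)
      moreover have "D * (4 / d * (d / 2 - dist x p)) = 4 * D / d * (d / 2 - dist x p)" by simp
      ultimately have le: "infdist x (frontier \<Omega>) \<le> 4 * D / d * (d / 2 - dist x p)" by linarith
      show "\<exists>y. ball y (d / 4) \<subseteq> cball p (d / 2) \<and> ball y (d / 2) \<subseteq> \<Omega> \<and> x \<in> ball y (d / 2)
        \<and> infdist x (frontier \<Omega>) \<le> 4 * D / d * (d / 2 - dist x y)"
        using x d by (intro exI[of _ p] conjI le) auto
    qed (use d D in auto)
    then show ?thesis
      using d lower_bound_subset[of _ _ "ball p (d / 4)"] by (intro exI[of _ "d / 4"]) auto
  qed
qed

theorem lemma1p1:
  fixes \<Omega> :: "(real^'n::finite) set" and lam Lam \<delta> :: real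
  assumes "open \<Omega>" and "connected \<Omega>" and "bounded \<Omega>" and "has_C2_boundary \<Omega>"
    and "0 < lam" and "0 < Lam" and "0 < \<delta>"
  shows "\<exists>\<epsilon>>0. \<exists>\<mu>>0.
    \<forall>(a :: real^'n \<Rightarrow> real^'n^'n) (b :: real^'n \<Rightarrow> real^'n) (c :: real^'n \<Rightarrow> real) (z :: real^'n)
      (u :: real^'n \<Rightarrow> real).
      admissible_coeffs \<Omega> lam Lam a b c \<and> ball z \<delta> \<subseteq> \<Omega> \<and> lsc_on \<Omega> u
      \<and> viscosity_le \<Omega> a b c u \<epsilon> \<and> (\<forall>x\<in>\<Omega>. 0 \<le> u x) \<and> (\<forall>x\<in>ball z \<delta>. 1 \<le> u x)
      \<longrightarrow> (\<forall>x\<in>\<Omega>. \<mu> * infdist x (frontier \<Omega>) \<le> u x)"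
proof -
  interpret elliptic_class \<Omega> lam Lam using assms by unfold_locales
  \<comment> \<open>Each ball of radius \<open>\<delta>\<close> in \<open>\<Omega>\<close> contains one of finitely many balls of radius \<open>\<delta> / 2\<close>.\<close>
  define Z where "Z = {z. ball z \<delta> \<subseteq> \<Omega>}"
  have "compact Z" "Z \<subseteq> \<Omega>"
    using compact_inner_parallel_set[OF \<open>bounded \<Omega>\<close> \<open>0 < \<delta>\<close>] \<open>0 < \<delta>\<close> by (auto simp: Z_def)
  have "Z \<subseteq> (\<Union>z\<in>Z. ball z (\<delta> / 2))" using \<open>0 < \<delta>\<close> by fastforce
  then obtain F where F: "F \<subseteq> Z" "finite F" "Z \<subseteq> (\<Union>z\<in>F. ball z (\<delta> / 2))"
    by (rule compactE_image[OF \<open>compact Z\<close> open_ball])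
  have "\<forall>\<^sub>F t in at_right 0. \<forall>z\<in>F. \<forall>u. nonneg_supersolution \<Omega> lam Lam t u
      \<longrightarrow> (\<forall>x\<in>ball z (\<delta> / 2). 1 \<le> u x) \<longrightarrow> (\<forall>x\<in>\<Omega>. t * infdist x (frontier \<Omega>) \<le> u x)"
    using lower_bound_infdist_frontier[of _ "\<delta> / 2"] assms F \<open>Z \<subseteq> \<Omega>\<close>
    unfolding lower_bound_def by (intro eventually_ball_finite) auto
  moreover have "\<forall>\<^sub>F t in at_right (0::real). 0 < t" by (rule eventually_at_right_less)
  ultimately have "\<forall>\<^sub>F t in at_right 0. 0 < t \<and> (\<forall>z\<in>F. \<forall>u. nonneg_supersolution \<Omega> lam Lam t u
      \<longrightarrow> (\<forall>x\<in>ball z (\<delta> / 2). 1 \<le> u x) \<longrightarrow> (\<forall>x\<in>\<Omega>. t * infdist x (frontier \<Omega>) \<le> u x))"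
    by eventually_elim simp
  then obtain t where "0 < t" and t: "\<And>z u. \<lbrakk>z \<in> F; nonneg_supersolution \<Omega> lam Lam t u;
      \<forall>x\<in>ball z (\<delta> / 2). 1 \<le> u x\<rbrakk> \<Longrightarrow> \<forall>x\<in>\<Omega>. t * infdist x (frontier \<Omega>) \<le> u x"
    using eventually_happens'[OF trivial_limit_at_right_real] by blast
  show ?thesis
  proof (intro exI[of _ t] conjI allI impI \<open>0 < t\<close>)
    fix a b c z u
    assume *: "admissible_coeffs \<Omega> lam Lam a b c \<and> ball z \<delta> \<subseteq> \<Omega> \<and> lsc_on \<Omega> u
      \<and> viscosity_le \<Omega> a b c u t \<and> (\<forall>x\<in>\<Omega>. 0 \<le> u x) \<and> (\<forall>x\<in>ball z \<delta>. 1 \<le> u x)"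
    then have u: "nonneg_supersolution \<Omega> lam Lam t u" by (auto simp: nonneg_supersolution_def)
    obtain z' where z': "z' \<in> F" "z \<in> ball z' (\<delta> / 2)" using F * by (auto simp: Z_def)
    then have "ball z' (\<delta> / 2) \<subseteq> ball z \<delta>" by (simp add: ball_subset_ball_iff)
    then show "\<forall>x\<in>\<Omega>. t * infdist x (frontier \<Omega>) \<le> u x"
      using * by (intro t[OF z'(1) u]) blast
  qed
qed

end
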